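(* Assume that for each $t\in[T]$ there are an orthogonal matrix $\boldsymbol U_t\in\mathbb R^{p\times p}$ and positive definite diagonal matrices $\boldsymbol\Gamma_t=\mathrm{diag}\{\gamma_1^{(t)},\dots,\gamma_p^{(t)}\}$, $\boldsymbol S_t=\mathrm{diag}\{s_1^{(t)},\dots,s_p^{(t)}\}$ and $\boldsymbol\Lambda_t=\mathrm{diag}\{\lambda_1^{(t)},\dots,\lambda_p^{(t)}\}$ such that $\boldsymbol\Sigma_t=\boldsymbol U_t\boldsymbol\Gamma_t\boldsymbol U_t^\top$, $\boldsymbol A_t=\boldsymbol U_t\boldsymbol S_t\boldsymbol U_t^\top$, $\boldsymbol H_t=\boldsymbol U_t\boldsymbol\Lambda_t\boldsymbol U_t^\top$, and $$\lambda_j^{(t)}=\frac{\gamma_j^{(t)}(1-s_j^{(t)}\gamma_j^{(t)})^{m_t}}{1-(1-s_j^{(t)}\gamma_j^{(t)})^{m_t}}$$ for each $j\in[p]$ and $t\in[T]$ (in particular the denominators are nonzero). Then for each $t\in[T]$, $$\widehat{\boldsymbol w}_t^{(\mathrm{ES})}=\widehat{\boldsymbol w}_t^{(\mathrm{GR})},$$ where $\widehat{\boldsymbol w}_t^{(\mathrm{ES})}$ is the early stopping estimator with learning rate matrices $\boldsymbol A_t$ and iteration numbers $m_t$, and $\widehat{\boldsymbol w}_t^{(\mathrm{GR})}$ is the generalized $\ell_2$-regularized estimator with regularization weight matrices $\boldsymbol H_t$.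
   Context: Setting (continual linear regression). There are $T$ tasks. Task $t\in[T]=\{1,\dots,T\}$ has $n_t\ge1$ samples, a design matrix $\boldsymbol X_t\in\mathbb R^{n_t\times p}$ and response vector $\boldsymbol y_t=\boldsymbol X_t\boldsymbol w_*+\boldsymbol\varepsilon_t\in\mathbb R^{n_t}$, where $\boldsymbol w_*\in\mathbb R^p$ is a fixed parameter common to all tasks and $\boldsymbol\varepsilon_t\in\mathbb R^{n_t}$ is noise. Put $\boldsymbol\Sigma_t=\boldsymbol X_t^\top\boldsymbol X_t/n_t\in\mathbb R^{p\times p}$. Generalized $\ell_2$-regularized (GR) estimator with symmetric weight matrices $\boldsymbol H_t$: $\widehat{\boldsymbol w}_0^{(\mathrm{GR})}=0$ and, for $t\in[T]$, $$\widehat{\boldsymbol w}_t^{(\mathrm{GR})}=\arg\min_{\boldsymbol w\in\mathbb R^p}\Big\{\tfrac1{n_t}\|\boldsymbol X_t\boldsymbol w-\boldsymbol y_t\|^2+(\boldsymbol w-\widehat{\boldsymbol w}_{t-1}^{(\mathrm{GR})})^\top\boldsymbol H_t(\boldsymbol w-\widehat{\boldsymbol w}_{t-1}^{(\mathrm{GR})})\Big\}.$$ Early stopping (ES) estimator with learning rate matrices $\boldsymbol A_t\in\mathbb R^{p\times p}$ and iteration numbers $m_t\in\mathbb N$, $m_t\ge1$: $\widehat{\boldsymbol w}_0^{(\mathrm{ES})}=0$; for each $t=1,\dots,T$ set $\boldsymbol w_t^{(0)}=\widehat{\boldsymbol w}_{t-1}^{(\mathrm{ES})}$, $$\boldsymbol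 w_t^{(\tau)}=\boldsymbol w_t^{(\tau-1)}-\tfrac1{n_t}\boldsymbol A_t\boldsymbol X_t^\top(\boldsymbol X_t\boldsymbol w_t^{(\tau-1)}-\boldsymbol y_t),\qquad \tau=1,\dots,m_t,$$ and $\widehat{\boldsymbol w}_t^{(\mathrm{ES})}=\boldsymbol w_t^{(m_t)}$. *)

theory Defs
  imports Complex_Main "Jordan_Normal_Form.Matrix"
begin

text \<open>
  Sample sizes vary with the task, so matrices and vectors are those of Jordan_Normal_Form, with
  dimensions given by carrier sets. Coordinates are indexed from 0, tasks from 1.
\<close>

definition sq_norm :: "real vec \<Rightarrow> real" where
  "sq_norm v = v \<bullet> v"

text \<open>
  The library predicate orthogonal_mat only requires the columns to be nonzero and pairwise
  orthogonal; here they must also be normalized.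
\<close>

definition orthonormal_mat :: "nat \<Rightarrow> real mat \<Rightarrow> bool" where
  "orthonormal_mat p U \<longleftrightarrow>
     U \<in> carrier_mat p p \<and> U\<^sup>T * U = 1\<^sub>m p \<and> U * U\<^sup>T = 1\<^sub>m p"

definition positive_definite_mat :: "nat \<Rightarrow> real mat \<Rightarrow> bool" where
  "positive_definite_mat p M \<longleftrightarrow>
     M \<in> carrier_mat p p \<and> M\<^sup>T = M \<and>
     (\<forall>x \<in> carrier_vec p. x \<noteq> 0\<^sub>v p \<longrightarrow> x \<bullet> (M *\<^sub>v x) > 0)"

definition sample_cov :: "nat \<Rightarrow> real mat \<Rightarrow> real mat" where
  "sample_cov n X = (1 / real n) \<cdot>\<^sub>m (X\<^sup>T * X)"

definition gr_objective ::
  "nat \<Rightarrow> real mat \<Rightarrow> real vec \<Rightarrow> real mat \<Rightarrow> real vec \<Rightarrow> real vec \<Rightarrow> real" where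
  "gr_objective n X y H v w =
     (1 / real n) * sq_norm (X *\<^sub>v w - y) + (w - v) \<bullet> (H *\<^sub>v (w - v))"

text \<open>
  Since arg_min is a choice among minimizers (and unspecified if there are none), an equation
  identifying the estimator below with a given vector can be derived only by showing that the
  vector is the unique minimizer.
\<close>

primrec gr_estimator ::
  "nat \<Rightarrow> (nat \<Rightarrow> nat) \<Rightarrow> (nat \<Rightarrow> real mat) \<Rightarrow> (nat \<Rightarrow> real vec) \<Rightarrow> (nat \<Rightarrow> real mat) \<Rightarrow>
   nat \<Rightarrow> real vec" where
  "gr_estimator p n X y H 0 = 0\<^sub>v p"
| "gr_estimator p n X y H (Suc t) =
     arg_min (gr_objective (n (Suc t)) (X (Suc t)) (y (Suc t)) (H (Suc t))
                (gr_estimator p n X y H t))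
             (\<lambda>w. w \<in> carrier_vec p)"

definition es_step :: "nat \<Rightarrow> real mat \<Rightarrow> real vec \<Rightarrow> real mat \<Rightarrow> real vec \<Rightarrow> real vec" where
  "es_step n X y A w = w - (1 / real n) \<cdot>\<^sub>v (A *\<^sub>v (X\<^sup>T *\<^sub>v (X *\<^sub>v w - y)))"

primrec es_estimator ::
  "nat \<Rightarrow> (nat \<Rightarrow> nat) \<Rightarrow> (nat \<Rightarrow> real mat) \<Rightarrow> (nat \<Rightarrow> real vec) \<Rightarrow> (nat \<Rightarrow> real mat) \<Rightarrow>
   (nat \<Rightarrow> nat) \<Rightarrow> nat \<Rightarrow> real vec" where
  "es_estimator p n X y A m 0 = 0\<^sub>v p"
| "es_estimator p n X y A m (Suc t) =
     (es_step (n (Suc t)) (X (Suc t)) (y (Suc t)) (A (Suc t)) ^^ m (Suc t))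
       (es_estimator p n X y A m t)"

end

theory Submission
  imports Defs
begin

text \<open>
  In the eigenbasis of the sample covariance an early stopping step multiplies the j-th coordinate
  of the least squares gradient by 1 - s_j gamma_j. After m steps that coordinate is r_j q_j with
  q_j = (1 - s_j gamma_j)^m and r_j its initial value, and the iterate has moved by
  (q_j - 1) r_j / gamma_j. The formula for lambda_j says precisely that the
  gradient plus lambda_j times the displacement vanishes, which is the normal equation of the
  regularized problem; its solution is the unique minimizer by strict convexity.
\<close>

section \<open>Diagonal matrices and conjugation by an orthogonal matrix\<close>

lemma mat_diag_mult_vec_index:
  fixes x :: "'a :: semiring_0 vec"
  assumes "x \<in> carrier_vec p" "j < p"
  shows "(mat_diag p d *\<^sub>v x) $ j = d j * x $ j"
proof -
  have "(mat_diag p d *\<^sub>v x) $ j = (\<Sum>k\<in>{0..<p}. (if j = k then d k else 0) * x $ k)"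
    using assms by (simp add: mat_diag_def scalar_prod_def)
  also have "\<dots> = (\<Sum>k\<in>{0..<p}. if k = j then d k * x $ k else 0)"
    by (intro sum.cong) auto
  finally show ?thesis using assms(2) by simp
qed

lemma orthonormal_mat_cancel:
  assumes "orthonormal_mat p U" "x \<in> carrier_vec p"
  shows "U *\<^sub>v (U\<^sup>T *\<^sub>v x) = x" "U\<^sup>T *\<^sub>v (U *\<^sub>v x) = x"
proof -
  have U: "U \<in> carrier_mat p p" "U\<^sup>T \<in> carrier_mat p p"
    and one: "U * U\<^sup>T = 1\<^sub>m p" "U\<^sup>T * U = 1\<^sub>m p"
    using assms(1) by (auto simp: orthonormal_mat_def)
  show "U *\<^sub>v (U\<^sup>T *\<^sub>v x) = x"
    using assoc_mult_mat_vec[OF U(1) U(2) assms(2)] assms(2) by (simp add: one)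
  show "U\<^sup>T *\<^sub>v (U *\<^sub>v x) = x"
    using assoc_mult_mat_vec[OF U(2) U(1) assms(2)] assms(2) by (simp add: one)
qed

lemma orth_conj_mult_vec:
  assumes "orthonormal_mat p U" "D \<in> carrier_mat p p" "x \<in> carrier_vec p"
  shows "(U * D * U\<^sup>T) *\<^sub>v x = U *\<^sub>v (D *\<^sub>v (U\<^sup>T *\<^sub>v x))"
proof -
  have U: "U \<in> carrier_mat p p" "U\<^sup>T \<in> carrier_mat p p"
    using assms(1) by (auto simp: orthonormal_mat_def)
  have "(U * D * U\<^sup>T) *\<^sub>v x = (U * D) *\<^sub>v (U\<^sup>T *\<^sub>v x)"
    using U assms by (intro assoc_mult_mat_vec[of _ p p _ p]) auto
  also have "\<dots> = U *\<^sub>v (D *\<^sub>v (U\<^sup>T *\<^sub>v x))"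
    using U assms by (intro assoc_mult_mat_vec[of _ p p _ p] mult_mat_vec_carrier[of _ p p]) auto
  finally show ?thesis .
qed

text \<open>Since \<open>U\<^sup>T * U\<close> cancels, a conjugated diagonal matrix acts on the
  coordinates \<open>U\<^sup>T *\<^sub>v x\<close> one at a time. The sample covariance, the
  learning rate matrix and the weight matrix share \<open>U\<close>, so all three become scalars in
  the same coordinates.\<close>

lemma orth_conj_coord:
  assumes "orthonormal_mat p U" "x \<in> carrier_vec p" "j < p"
  shows "(U\<^sup>T *\<^sub>v ((U * mat_diag p d * U\<^sup>T) *\<^sub>v x)) $ j = d j * (U\<^sup>T *\<^sub>v x) $ j"
proof -
  have U: "U\<^sup>T \<in> carrier_mat p p"
    using assms(1) by (auto simp: orthonormal_mat_def)
  have x: "U\<^sup>T *\<^sub>v x \<in> carrier_vec p"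
    using U assms(2) by (rule mult_mat_vec_carrier)
  have "mat_diag p d *\<^sub>v (U\<^sup>T *\<^sub>v x) \<in> carrier_vec p"
    using mat_diag_dim x by (rule mult_mat_vec_carrier)
  then show ?thesis
    using assms x
    by (simp only: orth_conj_mult_vec mat_diag_dim orthonormal_mat_cancel mat_diag_mult_vec_index)
qed

text \<open>The substitution z = \<open>U\<^sup>T *\<^sub>v x\<close> turns one quadratic form into
  the other, and z is nonzero because x = U z.\<close>

lemma positive_definite_orth_conj:
  assumes U: "orthonormal_mat p U" and D: "positive_definite_mat p D"
  shows "positive_definite_mat p (U * D * U\<^sup>T)"
proof -
  have Uc: "U \<in> carrier_mat p p" "U\<^sup>T \<in> carrier_mat p p"
    using U by (auto simp: orthonormal_mat_def)
  have Dc: "D \<in> carrier_mat p p" and Dt: "D\<^sup>T = D"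
    using D by (auto simp: positive_definite_mat_def)
  have "(U * D * U\<^sup>T)\<^sup>T = U * (D * U\<^sup>T)"
    using Uc Dc Dt transpose_mult[OF mult_carrier_mat[OF Uc(1) Dc] Uc(2)]
      transpose_mult[OF Uc(1) Dc] by simp
  then have sym: "(U * D * U\<^sup>T)\<^sup>T = U * D * U\<^sup>T"
    using assoc_mult_mat[OF Uc(1) Dc Uc(2)] by simp
  have "x \<bullet> ((U * D * U\<^sup>T) *\<^sub>v x) > 0" if x: "x \<in> carrier_vec p" "x \<noteq> 0\<^sub>v p" for x
  proof -
    let ?z = "U\<^sup>T *\<^sub>v x"
    have z: "?z \<in> carrier_vec p"
      using Uc(2) x(1) by (rule mult_mat_vec_carrier)
    have "?z \<noteq> 0\<^sub>v p"
    proof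
      assume "?z = 0\<^sub>v p"
      then have "x = U *\<^sub>v 0\<^sub>v p"
        using orthonormal_mat_cancel(1)[OF U x(1)] by simp
      then show False
        using Uc(1) x(2) by auto
    qed
    then have "?z \<bullet> (D *\<^sub>v ?z) > 0"
      using D z by (auto simp: positive_definite_mat_def)
    moreover have "x \<bullet> (U *\<^sub>v (D *\<^sub>v ?z)) = ?z \<bullet> (D *\<^sub>v ?z)"
      using transpose_vec_mult_scalar[OF Uc(1) mult_mat_vec_carrier[OF Dc z] x(1)] by simp
    ultimately show ?thesis
      using U Dc x(1) by (simp only: orth_conj_mult_vec)
  qed
  then show ?thesis
    using sym Uc Dc by (auto simp: positive_definite_mat_def intro!: mult_carrier_mat)
qed

section \<open>The least squares loss and its gradient\<close>

lemma sq_norm_nonneg: "sq_norm v \<ge> 0"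
  by (auto simp: sq_norm_def scalar_prod_def intro!: sum_nonneg)

text \<open>Half the gradient of the loss (1/n) |X w - y|^2. The factor 2 is dropped because the
  regularizer's gradient carries it as well.\<close>

definition lsq_grad :: "nat \<Rightarrow> real mat \<Rightarrow> real vec \<Rightarrow> real vec \<Rightarrow> real vec" where
  "lsq_grad n X y w = (1 / real n) \<cdot>\<^sub>v (X\<^sup>T *\<^sub>v (X *\<^sub>v w - y))"

lemma lsq_grad_carrier:
  assumes "X \<in> carrier_mat n p" "y \<in> carrier_vec n" "w \<in> carrier_vec p"
  shows "lsq_grad n X y w \<in> carrier_vec p"
proof -
  have "X\<^sup>T *\<^sub>v (X *\<^sub>v w - y) \<in> carrier_vec p"
    using assms by (intro mult_mat_vec_carrier[of _ p n]) auto
  then show ?thesis by (simp add: lsq_grad_def)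
qed

lemma smult_mat_mult_vec:
  fixes M :: "'a :: semiring_0 mat"
  assumes "M \<in> carrier_mat r c" "v \<in> carrier_vec c"
  shows "(k \<cdot>\<^sub>m M) *\<^sub>v v = k \<cdot>\<^sub>v (M *\<^sub>v v)"
  using assms by (intro eq_vecI) (auto simp: scalar_prod_def sum_distrib_left mult.assoc)

text \<open>The gradient is affine in \<open>w\<close>, and \<open>y\<close> cancels in the
  difference. This is where the sample covariance enters the argument.\<close>

lemma lsq_grad_diff:
  assumes X: "X \<in> carrier_mat n p" and y: "y \<in> carrier_vec n"
    and w: "w \<in> carrier_vec p" and v: "v \<in> carrier_vec p"
  shows "lsq_grad n X y w - lsq_grad n X y v = sample_cov n X *\<^sub>v (w - v)"
proof -
  have Xt: "X\<^sup>T \<in> carrier_mat p n" using X by simp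
  have Xw: "X *\<^sub>v w \<in> carrier_vec n" "X *\<^sub>v v \<in> carrier_vec n" and d: "w - v \<in> carrier_vec p"
    using X w v by auto
  have "X *\<^sub>v (w - v) = (X *\<^sub>v w - y) - (X *\<^sub>v v - y)"
    using X Xw y by (intro eq_vecI) (auto simp: mult_minus_distrib_mat_vec[OF X w v])
  then have "X\<^sup>T *\<^sub>v (X *\<^sub>v (w - v)) = X\<^sup>T *\<^sub>v (X *\<^sub>v w - y) - X\<^sup>T *\<^sub>v (X *\<^sub>v v - y)"
    using Xw y by (simp add: mult_minus_distrib_mat_vec[OF Xt])
  moreover have "sample_cov n X *\<^sub>v (w - v) = (1 / real n) \<cdot>\<^sub>v (X\<^sup>T *\<^sub>v (X *\<^sub>v (w - v)))"
    using X Xt d unfolding sample_cov_def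
    by (subst smult_mat_mult_vec[of _ p p]) (auto simp: assoc_mult_mat_vec[OF Xt X d])
  moreover have "X\<^sup>T *\<^sub>v (X *\<^sub>v w - y) \<in> carrier_vec p" "X\<^sup>T *\<^sub>v (X *\<^sub>v v - y) \<in> carrier_vec p"
    using Xt Xw y by (auto intro!: mult_mat_vec_carrier)
  ultimately show ?thesis
    unfolding lsq_grad_def by (intro eq_vecI) (auto simp: right_diff_distrib)
qed

text \<open>The scalar 1/n passes through \<open>A\<close>, which exhibits the step as gradient
  descent preconditioned by \<open>A\<close>.\<close>

lemma es_step_eq:
  assumes "X \<in> carrier_mat n p" "y \<in> carrier_vec n" "A \<in> carrier_mat p p" "w \<in> carrier_vec p"
  shows "es_step n X y A w = w - A *\<^sub>v lsq_grad n X y w"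
proof -
  have "X\<^sup>T *\<^sub>v (X *\<^sub>v w - y) \<in> carrier_vec p"
    using assms by (intro mult_mat_vec_carrier[of _ p n] minus_carrier_vec) auto
  then show ?thesis
    unfolding es_step_def lsq_grad_def using assms by (simp add: mult_mat_vec)
qed

section \<open>The unique minimizer of the regularized problem\<close>

text \<open>A quadratic function equals its second-order expansion exactly. The part linear in
  \<open>d\<close> is twice the inner product of \<open>d\<close> with the left side of the normal
  equation, hence zero.\<close>

lemma gr_objective_expand:
  assumes X: "X \<in> carrier_mat n p" and y: "y \<in> carrier_vec n"
    and H: "H \<in> carrier_mat p p" "H\<^sup>T = H"
    and v: "v \<in> carrier_vec p" and w: "w \<in> carrier_vec p" and d: "d \<in> carrier_vec p"
    and normal: "lsq_grad n X y w + H *\<^sub>v (w - v) = 0\<^sub>v p"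
  shows "gr_objective n X y H v (w + d) =
           gr_objective n X y H v w + (1 / real n) * sq_norm (X *\<^sub>v d) + d \<bullet> (H *\<^sub>v d)"
proof -
  define r where "r = X *\<^sub>v w - y"
  define z where "z = w - v"
  have r: "r \<in> carrier_vec n" and z: "z \<in> carrier_vec p" and Xd: "X *\<^sub>v d \<in> carrier_vec n"
    and Hz: "H *\<^sub>v z \<in> carrier_vec p" and Hd: "H *\<^sub>v d \<in> carrier_vec p"
    and Xr: "X\<^sup>T *\<^sub>v r \<in> carrier_vec p"
    using X y v w d H by (auto simp: r_def z_def intro!: mult_mat_vec_carrier)
  have 1: "X *\<^sub>v (w + d) - y = r + X *\<^sub>v d"
    using X y w d Xd by (intro eq_vecI) (auto simp: r_def mult_add_distrib_mat_vec[OF X])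
  have 2: "w + d - v = z + d"
    using v w d by (auto simp: z_def intro!: eq_vecI)
  have 3: "sq_norm (r + X *\<^sub>v d) = sq_norm r + 2 * ((X\<^sup>T *\<^sub>v r) \<bullet> d) + sq_norm (X *\<^sub>v d)"
    using r Xd transpose_vec_mult_scalar[OF X d r] comm_scalar_prod[OF r Xd]
    by (simp add: sq_norm_def add_scalar_prod_distrib[of _ n] scalar_prod_add_distrib[of _ n])
  \<comment> \<open>Symmetry of \<open>H\<close> makes the two cross terms of the quadratic form
    equal.\<close>
  have "z \<bullet> (H *\<^sub>v d) = (H *\<^sub>v z) \<bullet> d"
    using transpose_vec_mult_scalar[OF H(1) d z] H(2) by simp
  then have 4: "(z + d) \<bullet> (H *\<^sub>v (z + d)) =
      z \<bullet> (H *\<^sub>v z) + 2 * ((H *\<^sub>v z) \<bullet> d) + d \<bullet> (H *\<^sub>v d)"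
    using z d Hz Hd comm_scalar_prod[OF d Hz]
    by (simp add: mult_add_distrib_mat_vec[OF H(1)] add_scalar_prod_distrib[of _ p]
        scalar_prod_add_distrib[of _ p])
  \<comment> \<open>Pairing the normal equation with \<open>d\<close> gives the form in which it
    meets the cross terms of 3 and 4.\<close>
  have "(lsq_grad n X y w + H *\<^sub>v z) \<bullet> d = 0"
    using normal d by (simp add: z_def)
  then have 5: "(1 / real n) * ((X\<^sup>T *\<^sub>v r) \<bullet> d) + (H *\<^sub>v z) \<bullet> d = 0"
    using Xr Hz d by (simp add: lsq_grad_def flip: r_def)
      (simp add: add_scalar_prod_distrib[of _ p])
  have "gr_objective n X y H v (w + d) - (gr_objective n X y H v w
          + (1 / real n) * sq_norm (X *\<^sub>v d) + d \<bullet> (H *\<^sub>v d))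
      = 2 * ((1 / real n) * ((X\<^sup>T *\<^sub>v r) \<bullet> d) + (H *\<^sub>v z) \<bullet> d)"
    unfolding gr_objective_def 1 2 3 4 by (simp add: r_def z_def algebra_simps)
  then show ?thesis using 5 by simp
qed

text \<open>By the expansion, moving from \<open>w\<close> to another point raises the objective by
  at least the quadratic form of \<open>H\<close> at the displacement, which is positive. A strict
  minimizer leaves \<open>arg_min\<close> no choice.\<close>

lemma arg_min_gr_objective:
  assumes X: "X \<in> carrier_mat n p" and y: "y \<in> carrier_vec n"
    and H: "positive_definite_mat p H"
    and v: "v \<in> carrier_vec p" and w: "w \<in> carrier_vec p"
    and normal: "lsq_grad n X y w + H *\<^sub>v (w - v) = 0\<^sub>v p"
  shows "arg_min (gr_objective n X y H v) (\<lambda>w. w \<in> carrier_vec p) = w"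
proof -
  have less: "gr_objective n X y H v w < gr_objective n X y H v u"
    if u: "u \<in> carrier_vec p" "u \<noteq> w" for u
  proof -
    have d: "u - w \<in> carrier_vec p" and u_eq: "w + (u - w) = u"
      using u w by (auto intro!: eq_vecI)
    have "u - w \<noteq> 0\<^sub>v p"
      using u(2) u_eq w by auto
    then have "(u - w) \<bullet> (H *\<^sub>v (u - w)) > 0"
      using H d by (auto simp: positive_definite_mat_def)
    moreover have "(1 / real n) * sq_norm (X *\<^sub>v (u - w)) \<ge> 0"
      by (simp add: sq_norm_nonneg)
    ultimately show ?thesis
      using gr_objective_expand[OF X y _ _ v w d normal] H u_eq
      by (auto simp: positive_definite_mat_def)
  qed
  show ?thesis
    unfolding arg_min_def is_arg_min_def
  proof (rule some_equality)
    show "w \<in> carrier_vec p \<and>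
        (\<nexists>u. u \<in> carrier_vec p \<and> gr_objective n X y H v u < gr_objective n X y H v w)"
      using w less by (metis less_asym less_irrefl)
  qed (use w less in blast)
qed

section \<open>Early stopping on a single task, in the eigenbasis of its covariance\<close>

text \<open>The starting point of the iteration is not fixed here, so that it can later be the
  estimate left by the preceding task.\<close>

locale spectral_task =
  fixes n p :: nat and X U :: "real mat" and y :: "real vec" and \<gamma> s :: "nat \<Rightarrow> real"
  assumes X: "X \<in> carrier_mat n p" and y: "y \<in> carrier_vec n"
    and U: "orthonormal_mat p U"
    and cov: "sample_cov n X = U * mat_diag p \<gamma> * U\<^sup>T"
begin

abbreviation "g \<equiv> lsq_grad n X y"
abbreviation "coord x j \<equiv> (U\<^sup>T *\<^sub>v x) $ j"
abbreviation "A \<equiv> U * mat_diag p s * U\<^sup>T"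

lemma U_carrier: "U \<in> carrier_mat p p" "U\<^sup>T \<in> carrier_mat p p"
  using U by (auto simp: orthonormal_mat_def)

lemma conj_carrier: "U * mat_diag p d * U\<^sup>T \<in> carrier_mat p p"
  using U_carrier by (intro mult_carrier_mat[of _ p p]) auto

lemma g_carrier: "w \<in> carrier_vec p \<Longrightarrow> g w \<in> carrier_vec p"
  using X y by (rule lsq_grad_carrier)

lemma coord_diff:
  assumes "x \<in> carrier_vec p" "z \<in> carrier_vec p" "j < p"
  shows "coord (x - z) j = coord x j - coord z j"
  using mult_minus_distrib_mat_vec[OF U_carrier(2) assms(1,2)] U_carrier assms(3) by simp

lemma coord_add:
  assumes "x \<in> carrier_vec p" "z \<in> carrier_vec p" "j < p"
  shows "coord (x + z) j = coord x j + coord z j"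
  using mult_add_distrib_mat_vec[OF U_carrier(2) assms(1,2)] U_carrier assms(3) by simp

lemma coord_grad_diff:
  assumes "w \<in> carrier_vec p" "v \<in> carrier_vec p" "j < p"
  shows "coord (g w) j - coord (g v) j = \<gamma> j * (coord w j - coord v j)"
proof -
  have "coord (g w) j - coord (g v) j = coord (g w - g v) j"
    using assms by (simp only: coord_diff g_carrier)
  also have "\<dots> = coord ((U * mat_diag p \<gamma> * U\<^sup>T) *\<^sub>v (w - v)) j"
    using X y assms by (simp only: lsq_grad_diff cov)
  also have "\<dots> = \<gamma> j * (coord w j - coord v j)"
    using assms U by (simp only: orth_conj_coord minus_carrier_vec coord_diff)
  finally show ?thesis .
qed

lemma es_step_carrier:
  assumes "w \<in> carrier_vec p"
  shows "es_step n X y A w \<in> carrier_vec p"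
  using assms X y conj_carrier g_carrier
  by (simp only: es_step_eq) (intro minus_carrier_vec mult_mat_vec_carrier[of _ p p], auto)

lemma es_iterate_carrier:
  "w \<in> carrier_vec p \<Longrightarrow> (es_step n X y A ^^ k) w \<in> carrier_vec p"
  by (induction k) (auto intro: es_step_carrier)

text \<open>A step moves coordinate j of the iterate by -s_j times that of the gradient, and the
  gradient responds with slope \<gamma>_j. Following the gradient instead of the iterate makes the
  recursion homogeneous, so no least squares solution has to be subtracted.\<close>

lemma coord_grad_es_step:
  assumes w: "w \<in> carrier_vec p" and j: "j < p"
  shows "coord (g (es_step n X y A w)) j = (1 - s j * \<gamma> j) * coord (g w) j"
proof -
  have Ag: "A *\<^sub>v g w \<in> carrier_vec p"
    using conj_carrier g_carrier[OF w] by (rule mult_mat_vec_carrier)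
  have "coord (es_step n X y A w) j = coord w j - s j * coord (g w) j"
    using X y conj_carrier w j U Ag g_carrier[OF w]
    by (simp only: es_step_eq coord_diff orth_conj_coord)
  then have "coord (g (es_step n X y A w)) j - coord (g w) j = \<gamma> j * (- (s j * coord (g w) j))"
    using coord_grad_diff[OF es_step_carrier[OF w] w j] by simp
  then show ?thesis
    by (simp add: algebra_simps)
qed

lemma coord_grad_es_iterate:
  assumes "w \<in> carrier_vec p" "j < p"
  shows "coord (g ((es_step n X y A ^^ k) w)) j = (1 - s j * \<gamma> j) ^ k * coord (g w) j"
  by (induction k) (simp_all add: coord_grad_es_step es_iterate_carrier assms mult.assoc)

text \<open>As \<open>U\<close> is invertible, it suffices that every eigencoordinate of the left
  side vanishes, which is a scalar identity in q, r and \<delta>.\<close>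

lemma es_iterate_normal_equation:
  assumes v: "v \<in> carrier_vec p"
    and denom: "\<And>j. j < p \<Longrightarrow> 1 - (1 - s j * \<gamma> j) ^ k \<noteq> 0"
    and lam: "\<And>j. j < p \<Longrightarrow>
      lam j = \<gamma> j * (1 - s j * \<gamma> j) ^ k / (1 - (1 - s j * \<gamma> j) ^ k)"
    and w: "w = (es_step n X y A ^^ k) v"
  shows "g w + (U * mat_diag p lam * U\<^sup>T) *\<^sub>v (w - v) = 0\<^sub>v p" (is "?e = _")
proof -
  have wc: "w \<in> carrier_vec p"
    unfolding w using v by (rule es_iterate_carrier)
  have Hd: "(U * mat_diag p lam * U\<^sup>T) *\<^sub>v (w - v) \<in> carrier_vec p"
    using conj_carrier minus_carrier_vec[OF wc v] by (rule mult_mat_vec_carrier)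
  have e: "?e \<in> carrier_vec p"
    using g_carrier[OF wc] Hd by (rule add_carrier_vec)
  have "coord ?e j = 0" if j: "j < p" for j
  proof -
    define q where "q = (1 - s j * \<gamma> j) ^ k"
    define r where "r = coord (g v) j"
    define \<delta> where "\<delta> = coord w j - coord v j"
    have gw: "coord (g w) j = q * r"
      unfolding w q_def r_def using v j by (rule coord_grad_es_iterate)
    \<comment> \<open>The gradient changes by q r - r between \<open>v\<close> and \<open>w\<close>,
      and this is \<open>\<gamma> j\<close> times the total displacement, so the intermediate
      iterates need not be summed.\<close>
    have \<delta>: "\<gamma> j * \<delta> = (q - 1) * r"
      using coord_grad_diff[OF wc v j] gw by (simp add: \<delta>_def r_def algebra_simps)
    have lam_q: "lam j * (1 - q) = \<gamma> j * q"
      using lam[OF j] denom[OF j] by (simp add: q_def)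
    \<comment> \<open>After multiplication by the nonzero factor 1 - q, \<open>lam_q\<close> turns
      the second term into a multiple of \<open>\<gamma> j * \<delta>\<close>, which the preceding
      identity evaluates.\<close>
    have "(1 - q) * (q * r + lam j * \<delta>) = q * (1 - q) * r + lam j * (1 - q) * \<delta>"
      by (simp add: algebra_simps)
    also have "\<dots> = q * (1 - q) * r + q * (\<gamma> j * \<delta>)"
      unfolding lam_q by simp
    also have "\<dots> = 0"
      unfolding \<delta> by (simp add: algebra_simps)
    finally have "(1 - q) * (q * r + lam j * \<delta>) = 0" .
    then have "q * r + lam j * \<delta> = 0"
      using denom[OF j] by (simp add: q_def)
    moreover have "coord ?e j = q * r + lam j * \<delta>"
      using wc v j U Hd g_carrier[OF wc] gw
      by (simp only: coord_add orth_conj_coord minus_carrier_vec coord_diff \<delta>_def)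
    ultimately show ?thesis by simp
  qed
  then have "U\<^sup>T *\<^sub>v ?e = 0\<^sub>v p"
    using U_carrier by (intro eq_vecI) auto
  then have "?e = U *\<^sub>v 0\<^sub>v p"
    using orthonormal_mat_cancel(1)[OF U e] by simp
  then show ?thesis
    using U_carrier(1) by auto
qed

end

section \<open>Induction over the tasks\<close>

theorem theorem5p1:
  fixes T p :: nat
    and n m :: "nat \<Rightarrow> nat"
    and X U A H :: "nat \<Rightarrow> real mat"
    and y \<epsilon> :: "nat \<Rightarrow> real vec"
    and w_star :: "real vec"
    and \<gamma> s lam :: "nat \<Rightarrow> nat \<Rightarrow> real"
  assumes samples: "\<And>t. t \<in> {1..T} \<Longrightarrow> n t \<ge> 1"
    and iterations: "\<And>t. t \<in> {1..T} \<Longrightarrow> m t \<ge> 1"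
    and design: "\<And>t. t \<in> {1..T} \<Longrightarrow> X t \<in> carrier_mat (n t) p"
    and parameter: "w_star \<in> carrier_vec p"
    and noise: "\<And>t. t \<in> {1..T} \<Longrightarrow> \<epsilon> t \<in> carrier_vec (n t)"
    and response: "\<And>t. t \<in> {1..T} \<Longrightarrow> y t = X t *\<^sub>v w_star + \<epsilon> t"
    and U_orth: "\<And>t. t \<in> {1..T} \<Longrightarrow> orthonormal_mat p (U t)"
    and Gamma_pd: "\<And>t. t \<in> {1..T} \<Longrightarrow> positive_definite_mat p (mat_diag p (\<gamma> t))"
    and S_pd: "\<And>t. t \<in> {1..T} \<Longrightarrow> positive_definite_mat p (mat_diag p (s t))"
    and Lambda_pd: "\<And>t. t \<in> {1..T} \<Longrightarrow> positive_definite_mat p (mat_diag p (lam t))"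
    and Sigma_eq: "\<And>t. t \<in> {1..T} \<Longrightarrow>
          sample_cov (n t) (X t) = U t * mat_diag p (\<gamma> t) * (U t)\<^sup>T"
    and A_eq: "\<And>t. t \<in> {1..T} \<Longrightarrow> A t = U t * mat_diag p (s t) * (U t)\<^sup>T"
    and H_eq: "\<And>t. t \<in> {1..T} \<Longrightarrow> H t = U t * mat_diag p (lam t) * (U t)\<^sup>T"
    and denom: "\<And>t j. t \<in> {1..T} \<Longrightarrow> j < p \<Longrightarrow> 1 - (1 - s t j * \<gamma> t j) ^ m t \<noteq> 0"
    and lam_eq: "\<And>t j. t \<in> {1..T} \<Longrightarrow> j < p \<Longrightarrow>
          lam t j = \<gamma> t j * (1 - s t j * \<gamma> t j) ^ m t / (1 - (1 - s t j * \<gamma> t j) ^ m t)"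
  shows "\<forall>t \<in> {1..T}. es_estimator p n X y A m t = gr_estimator p n X y H t"
proof -
  have y: "y t \<in> carrier_vec (n t)" if t: "t \<in> {1..T}" for t
    using design[OF t] noise[OF t] response[OF t] parameter by simp
  \<comment> \<open>The induction starts from index 0, where both estimators are the zero vector.
    Membership in \<open>carrier_vec p\<close> is carried along because the single-task lemmas
    require it of the starting point.\<close>
  have "es_estimator p n X y A m t \<in> carrier_vec p \<and>
      es_estimator p n X y A m t = gr_estimator p n X y H t" if "t \<le> T" for t
    using that
  proof (induction t)
    case 0
    then show ?case by simp
  next
    case (Suc t)
    define v where "v = es_estimator p n X y A m t"
    define w where "w = es_estimator p n X y A m (Suc t)"
    \<comment> \<open>By the induction hypothesis the early stopping iteration starts exactly at the
      center of the regularizer, so one vector \<open>v\<close> serves both problems.\<close>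
    have v: "v \<in> carrier_vec p" and v_gr: "gr_estimator p n X y H t = v"
      using Suc by (auto simp: v_def)
    have t: "Suc t \<in> {1..T}" using Suc.prems by simp
    interpret task: spectral_task "n (Suc t)" p "X (Suc t)" "U (Suc t)" "y (Suc t)"
        "\<gamma> (Suc t)" "s (Suc t)"
      using design[OF t] y[OF t] U_orth[OF t] Sigma_eq[OF t] by unfold_locales
    have w_iter: "w = (es_step (n (Suc t)) (X (Suc t)) (y (Suc t))
        (U (Suc t) * mat_diag p (s (Suc t)) * (U (Suc t))\<^sup>T) ^^ m (Suc t)) v"
      by (simp add: w_def v_def A_eq[OF t])
    have w: "w \<in> carrier_vec p"
      unfolding w_iter using v by (rule task.es_iterate_carrier)
    have "lsq_grad (n (Suc t)) (X (Suc t)) (y (Suc t)) w + H (Suc t) *\<^sub>v (w - v) = 0\<^sub>v p"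
      unfolding H_eq[OF t]
      using v denom[OF t] lam_eq[OF t] w_iter by (rule task.es_iterate_normal_equation)
    moreover have "positive_definite_mat p (H (Suc t))"
      unfolding H_eq[OF t] using U_orth[OF t] Lambda_pd[OF t] by (rule positive_definite_orth_conj)
    ultimately have "gr_estimator p n X y H (Suc t) = w"
      using arg_min_gr_objective[OF design[OF t] y[OF t] _ v w] v_gr by simp
    then show ?case
      using w by (simp add: w_def)
  qed
  then show ?thesis by simp
qed

end
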